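(* Let $(X,T,A)$ be a soft $T_{0U}$ topological space. Then the following statements are equivalent: (a) $(X,T,A)$ is a soft $T_{(0,3)}$ space. (b) Both of the following hold: (i) $(X,T,A)$ is a soft $T_{(0,1)}$ space; (ii) $(X,T,A)$ is a soft regular space.
   Context: A soft set over a set $X$ with parameter set $A$ is a pair $(F,A)$ with $F:A\to\mathcal P(X)$; $SS(X)_A$ is the set of all of them. $0_A$ and $1_A$ denote the soft sets with constant value $\emptyset$, respectively $X$. Soft union, soft intersection $\sqcap$, complement $(F,A)^c$ and inclusion $\sqsubseteq$ are defined parameterwise. For $x\in X$, $x\in(F,A)$ means $x\in F(a)$ for all $a\in A$; $x\notin(F,A)$ means $x\notin F(a)$ for some $a\in A$. A soft topology on $X$ is a family $T\subseteq SS(X)_A$ containing $0_A,1_A$ and closed under binary soft intersections and arbitrary soft unions; members of $T$ are soft open, their complements are soft closed. A soft neighbourhood of $x$ is a soft set $(F,A)$ such that $x\in(G,A)\sqsubseteq(F,A)$ for some $(G,A)\in T$; $\mathcal U_x$ is the collection of these. Write $x\approx y$ if $x\in(G,A)$ for each $(G,A)\in\mathcal U_y$ and $y\in(F,A)$ for each $(F,A)\in\mathcal U_x$. The space is soft $T_{0U}$ if whenever $x\approx y$, for every $a\in A$ and $(F,A)\in T$: $x\in F(a)$ if and only if $y\in F(a)$. Soft $T_0$ reflection: $X_0$ is the set of equivalence classes of $\approx$ on $X$, $r_X:X\to X_0$ the canonical surjection, and $T_0$ is the soft topology on $X_0$ consisting of those $(F,A)\in SS(X_0)_A$ for which the soft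 set $a\mapsto r_X^{-1}(F(a))$ belongs to $T$; $(X_0,T_0,A)$ is the soft $T_0$ reflection of $(X,T,A)$. A soft topological space is soft $T_1$ if for all distinct points $x,y$ there are soft open sets $(G,A),(H,A)$ with $x\in(G,A)$, $y\notin(G,A)$, $y\in(H,A)$, $x\notin(H,A)$. It is soft regular if for each soft closed $(F,A)$ and each point $x$ with $x\notin(F,A)$ there are soft open $(G,A),(H,A)$ with $x\in(G,A)$, $(F,A)\sqsubseteq(H,A)$ and $(G,A)\sqcap(H,A)=0_A$. It is soft $T_3$ if it is soft regular and soft $T_1$. $(X,T,A)$ is soft $T_{(0,1)}$ (respectively soft $T_{(0,3)}$) if $(X_0,T_0,A)$ is soft $T_1$ (respectively soft $T_3$). *)

theory Defs
  imports "HOL-Library.FuncSet"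
begin

(* A soft set (F,A) over X is an extensional function on A with values in Pow X, so that
   equality of soft sets is equality of functions. *)

definition soft_sets :: "'a set \<Rightarrow> 'p set \<Rightarrow> ('p \<Rightarrow> 'a set) set" where
  "soft_sets X A = A \<rightarrow>\<^sub>E Pow X"

definition soft_null :: "'p set \<Rightarrow> 'p \<Rightarrow> 'a set" where
  "soft_null A = (\<lambda>a\<in>A. {})"

definition soft_whole :: "'a set \<Rightarrow> 'p set \<Rightarrow> 'p \<Rightarrow> 'a set" where
  "soft_whole X A = (\<lambda>a\<in>A. X)"

definition soft_Union :: "'p set \<Rightarrow> ('p \<Rightarrow> 'a set) set \<Rightarrow> 'p \<Rightarrow> 'a set" where
  "soft_Union A S = (\<lambda>a\<in>A. \<Union>F\<in>S. F a)"

definition soft_inter :: "'p set \<Rightarrow> ('p \<Rightarrow> 'a set) \<Rightarrow> ('p \<Rightarrow> 'a set) \<Rightarrow> 'p \<Rightarrow> 'a set" where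
  "soft_inter A F G = (\<lambda>a\<in>A. F a \<inter> G a)"

definition soft_compl :: "'a set \<Rightarrow> 'p set \<Rightarrow> ('p \<Rightarrow> 'a set) \<Rightarrow> 'p \<Rightarrow> 'a set" where
  "soft_compl X A F = (\<lambda>a\<in>A. X - F a)"

definition soft_subset :: "'p set \<Rightarrow> ('p \<Rightarrow> 'a set) \<Rightarrow> ('p \<Rightarrow> 'a set) \<Rightarrow> bool" where
  "soft_subset A F G \<longleftrightarrow> (\<forall>a\<in>A. F a \<subseteq> G a)"

(* Non-membership is the negation: some parameter a in A has x outside F a. *)
definition soft_mem :: "'p set \<Rightarrow> 'a \<Rightarrow> ('p \<Rightarrow> 'a set) \<Rightarrow> bool" where
  "soft_mem A x F \<longleftrightarrow> (\<forall>a\<in>A. x \<in> F a)"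

definition soft_topology :: "'a set \<Rightarrow> 'p set \<Rightarrow> ('p \<Rightarrow> 'a set) set \<Rightarrow> bool" where
  "soft_topology X A T \<longleftrightarrow>
     T \<subseteq> soft_sets X A \<and>
     soft_null A \<in> T \<and> soft_whole X A \<in> T \<and>
     (\<forall>F\<in>T. \<forall>G\<in>T. soft_inter A F G \<in> T) \<and>
     (\<forall>S. S \<subseteq> T \<longrightarrow> soft_Union A S \<in> T)"

definition soft_closed :: "'a set \<Rightarrow> 'p set \<Rightarrow> ('p \<Rightarrow> 'a set) set \<Rightarrow> ('p \<Rightarrow> 'a set) \<Rightarrow> bool" where
  "soft_closed X A T F \<longleftrightarrow> (\<exists>G\<in>T. F = soft_compl X A G)"

definition soft_nhds :: "'a set \<Rightarrow> 'p set \<Rightarrow> ('p \<Rightarrow> 'a set) set \<Rightarrow> 'a \<Rightarrow> ('p \<Rightarrow> 'a set) set" where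
  "soft_nhds X A T x =
     {F \<in> soft_sets X A. \<exists>G\<in>T. soft_mem A x G \<and> soft_subset A G F}"

definition soft_indist :: "'a set \<Rightarrow> 'p set \<Rightarrow> ('p \<Rightarrow> 'a set) set \<Rightarrow> ('a \<times> 'a) set" where
  "soft_indist X A T =
     {(x, y) \<in> X \<times> X.
        (\<forall>G \<in> soft_nhds X A T y. soft_mem A x G) \<and>
        (\<forall>F \<in> soft_nhds X A T x. soft_mem A y F)}"

definition soft_T0U :: "'a set \<Rightarrow> 'p set \<Rightarrow> ('p \<Rightarrow> 'a set) set \<Rightarrow> bool" where
  "soft_T0U X A T \<longleftrightarrow>
     (\<forall>(x, y) \<in> soft_indist X A T. \<forall>a\<in>A. \<forall>F\<in>T. x \<in> F a \<longleftrightarrow> y \<in> F a)"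

definition refl_space :: "'a set \<Rightarrow> 'p set \<Rightarrow> ('p \<Rightarrow> 'a set) set \<Rightarrow> 'a set set" where
  "refl_space X A T = X // soft_indist X A T"

definition refl_map :: "'a set \<Rightarrow> 'p set \<Rightarrow> ('p \<Rightarrow> 'a set) set \<Rightarrow> 'a \<Rightarrow> 'a set" where
  "refl_map X A T x = soft_indist X A T `` {x}"

definition refl_topology :: "'a set \<Rightarrow> 'p set \<Rightarrow> ('p \<Rightarrow> 'a set) set \<Rightarrow> ('p \<Rightarrow> 'a set set) set" where
  "refl_topology X A T =
     {F \<in> soft_sets (refl_space X A T) A. (\<lambda>a\<in>A. {x \<in> X. refl_map X A T x \<in> F a}) \<in> T}"

definition soft_T1 :: "'a set \<Rightarrow> 'p set \<Rightarrow> ('p \<Rightarrow> 'a set) set \<Rightarrow> bool" where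
  "soft_T1 X A T \<longleftrightarrow>
     (\<forall>x\<in>X. \<forall>y\<in>X. x \<noteq> y \<longrightarrow>
        (\<exists>G\<in>T. \<exists>H\<in>T. soft_mem A x G \<and> \<not> soft_mem A y G \<and>
                       soft_mem A y H \<and> \<not> soft_mem A x H))"

definition soft_regular :: "'a set \<Rightarrow> 'p set \<Rightarrow> ('p \<Rightarrow> 'a set) set \<Rightarrow> bool" where
  "soft_regular X A T \<longleftrightarrow>
     (\<forall>F. \<forall>x\<in>X. soft_closed X A T F \<and> \<not> soft_mem A x F \<longrightarrow>
        (\<exists>G\<in>T. \<exists>H\<in>T. soft_mem A x G \<and> soft_subset A F H \<and>
                       soft_inter A G H = soft_null A))"

definition soft_T3 :: "'a set \<Rightarrow> 'p set \<Rightarrow> ('p \<Rightarrow> 'a set) set \<Rightarrow> bool" where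
  "soft_T3 X A T \<longleftrightarrow> soft_regular X A T \<and> soft_T1 X A T"

definition soft_T01 :: "'a set \<Rightarrow> 'p set \<Rightarrow> ('p \<Rightarrow> 'a set) set \<Rightarrow> bool" where
  "soft_T01 X A T \<longleftrightarrow> soft_T1 (refl_space X A T) A (refl_topology X A T)"

definition soft_T03 :: "'a set \<Rightarrow> 'p set \<Rightarrow> ('p \<Rightarrow> 'a set) set \<Rightarrow> bool" where
  "soft_T03 X A T \<longleftrightarrow> soft_T3 (refl_space X A T) A (refl_topology X A T)"

lemma soft_indist_iff:
  assumes "soft_topology X A T"
  shows "(x, y) \<in> soft_indist X A T \<longleftrightarrow>
     x \<in> X \<and> y \<in> X \<and> (\<forall>G\<in>T. soft_mem A x G \<longleftrightarrow> soft_mem A y G)"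
proof -
  have T: "G \<in> soft_nhds X A T z" if "G \<in> T" "soft_mem A z G" for G z
    using that assms by (auto simp: soft_nhds_def soft_topology_def soft_subset_def)
  have N: "soft_mem A z F"
    if nF: "F \<in> soft_nhds X A T w" and G: "\<forall>G\<in>T. soft_mem A w G \<longrightarrow> soft_mem A z G" for F w z
  proof -
    obtain G where "G \<in> T" "soft_mem A w G" "soft_subset A G F"
      using nF unfolding soft_nhds_def by blast
    then show ?thesis
      using G unfolding soft_subset_def soft_mem_def by blast
  qed
  show ?thesis
    unfolding soft_indist_def using T N by blast
qed

lemma equiv_soft_indist:
  assumes "soft_topology X A T"
  shows "equiv X (soft_indist X A T)"
proof (rule equivI)
  show "soft_indist X A T \<subseteq> X \<times> X"
    unfolding soft_indist_def by blast
  show "refl_on X (soft_indist X A T)"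
    by (simp add: refl_on_def soft_indist_iff[OF assms])
  show "sym (soft_indist X A T)"
    by (simp add: sym_def soft_indist_iff[OF assms])
  show "trans (soft_indist X A T)"
    by (simp add: trans_def soft_indist_iff[OF assms])
qed

lemma soft_topology_refl:
  assumes "soft_topology X A T"
  shows "soft_topology (refl_space X A T) A (refl_topology X A T)"
proof -
  let ?r = "refl_map X A T"
  let ?p = "\<lambda>F. (\<lambda>a\<in>A. {x \<in> X. ?r x \<in> F a})"
  have r: "?r x \<in> refl_space X A T" if "x \<in> X" for x
    using that by (auto simp: refl_space_def refl_map_def quotient_def)
  have n: "?p (soft_null A) = soft_null A"
    by (auto simp: soft_null_def restrict_def fun_eq_iff)
  have w: "?p (soft_whole (refl_space X A T) A) = soft_whole X A"
    using r by (auto simp: soft_whole_def restrict_def fun_eq_iff)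
  have i: "?p (soft_inter A F G) = soft_inter A (?p F) (?p G)" for F G
    by (auto simp: soft_inter_def restrict_def fun_eq_iff)
  have u: "?p (soft_Union A S) = soft_Union A (?p ` S)" for S
    by (auto simp: soft_Union_def restrict_def fun_eq_iff)
  have U: "soft_Union A (?p ` S) \<in> T" if "S \<subseteq> refl_topology X A T" for S
  proof -
    have "?p ` S \<subseteq> T" using that by (auto simp: refl_topology_def)
    then show ?thesis using assms unfolding soft_topology_def by blast
  qed
  have I: "soft_inter A (?p F) (?p G) \<in> T"
    if "F \<in> refl_topology X A T" "G \<in> refl_topology X A T" for F G
    using that assms unfolding soft_topology_def refl_topology_def by blast
  have s0: "soft_null A \<in> soft_sets Y A" "soft_whole Y A \<in> soft_sets Y A" for Y :: "'a set set"
    by (auto simp: soft_sets_def soft_null_def soft_whole_def)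
  have si: "soft_inter A F G \<in> soft_sets Y A" if "F \<in> soft_sets Y A"
    for F G and Y :: "'a set set"
    using that by (fastforce simp: soft_sets_def soft_inter_def PiE_iff)
  have su: "soft_Union A S \<in> soft_sets Y A" if "S \<subseteq> soft_sets Y A"
    for S and Y :: "'a set set"
    using that by (fastforce simp: soft_sets_def soft_Union_def PiE_iff)
  have sub: "refl_topology X A T \<subseteq> soft_sets (refl_space X A T) A"
    by (auto simp: refl_topology_def)
  have mem: "F \<in> refl_topology X A T"
    if "F \<in> soft_sets (refl_space X A T) A" "?p F \<in> T" for F
    using that by (simp add: refl_topology_def)
  show ?thesis
    unfolding soft_topology_def
  proof (intro conjI ballI allI impI)
    show "soft_null A \<in> refl_topology X A T"
      using assms by (intro mem s0) (simp only: n soft_topology_def)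
    show "soft_whole (refl_space X A T) A \<in> refl_topology X A T"
      using assms by (intro mem s0) (simp only: w soft_topology_def)
    show "soft_inter A F G \<in> refl_topology X A T"
      if "F \<in> refl_topology X A T" "G \<in> refl_topology X A T" for F G
      using that sub I[OF that] by (intro mem si) (auto simp only: i)
    show "soft_Union A S \<in> refl_topology X A T" if "S \<subseteq> refl_topology X A T" for S
      using that sub U[OF that] by (intro mem su) (auto simp only: u)
  qed (rule sub)
qed

end

theory Submission
  imports Defs
begin

text \<open>
  Soft regularity only speaks of the lattice of soft open sets and of which points lie in which
  parts of them. It is therefore unaffected when the points of a space are replaced by those of
  another one along a surjection whose inverse image map sends the soft open sets of one space
  onto those of the other (\<open>soft_regular_vimage\<close>). The canonical surjection onto the soft \<open>T\<^sub>0\<close>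
  reflection always pulls soft open sets back to soft open sets. The soft \<open>T\<^sub>0\<^sub>U\<close> axiom says exactly
  that each part \<open>F a\<close> of a soft open set is a union of equivalence classes, so that \<open>F\<close> is the
  inverse image of its own image and every soft open set arises in this way
  (\<open>soft_topology_eq_vimage_refl\<close>). Consequently a soft \<open>T\<^sub>0\<^sub>U\<close> space is soft regular if and only if
  its reflection is. The proposition follows, because soft \<open>T\<^sub>3\<close> is the conjunction of soft regular
  and soft \<open>T\<^sub>1\<close>, and the two sides of the equivalence impose the same soft \<open>T\<^sub>1\<close> condition on the
  reflection.
\<close>

definition soft_vimage :: "'a set \<Rightarrow> 'p set \<Rightarrow> ('a \<Rightarrow> 'b) \<Rightarrow> ('p \<Rightarrow> 'b set) \<Rightarrow> 'p \<Rightarrow> 'a set" where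
  "soft_vimage X A r F = (\<lambda>a\<in>A. {x \<in> X. r x \<in> F a})"

text \<open>
  Replacing each soft closed set by its soft open complement leaves only quantifiers over soft open
  sets and points, and in this form the condition can be transported along a surjection. A point
  lies outside the complement of \<open>U\<close> as soon as it lies in \<open>U a\<close> for a single parameter \<open>a\<close>, hence
  the existential quantifier in the premise.
\<close>

lemma soft_regular_iff_open:
  fixes X :: "'a set" and A :: "'p set"
  shows "soft_regular X A T \<longleftrightarrow>
     (\<forall>U\<in>T. \<forall>x\<in>X. (\<exists>a\<in>A. x \<in> U a) \<longrightarrow>
        (\<exists>G\<in>T. \<exists>H\<in>T. (\<forall>a\<in>A. x \<in> G a) \<and> (\<forall>a\<in>A. X \<subseteq> U a \<union> H a) \<and>
                       (\<forall>a\<in>A. G a \<inter> H a = {})))"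
proof -
  have notin: "\<not> soft_mem A x (soft_compl X A U) \<longleftrightarrow> (\<exists>a\<in>A. x \<in> U a)" if "x \<in> X" for x U
    using that by (simp add: soft_mem_def soft_compl_def)
  have cover: "soft_subset A (soft_compl X A U) H \<longleftrightarrow> (\<forall>a\<in>A. X \<subseteq> U a \<union> H a)" for U H
    by (simp add: soft_subset_def soft_compl_def Diff_subset_conv)
  have disjoint: "soft_inter A G H = soft_null A \<longleftrightarrow> (\<forall>a\<in>A. G a \<inter> H a = {})"
    for G H :: "'p \<Rightarrow> 'a set"
    by (auto simp: soft_inter_def soft_null_def restrict_def fun_eq_iff)
  have "soft_regular X A T \<longleftrightarrow>
      (\<forall>U\<in>T. \<forall>x\<in>X. \<not> soft_mem A x (soft_compl X A U) \<longrightarrow>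
        (\<exists>G\<in>T. \<exists>H\<in>T. soft_mem A x G \<and> soft_subset A (soft_compl X A U) H \<and>
                       soft_inter A G H = soft_null A))"
    unfolding soft_regular_def soft_closed_def by blast
  then show ?thesis
    by (simp only: notin cover disjoint soft_mem_def[symmetric] cong: ball_cong)
qed

text \<open>
  Surjectivity onto \<open>Y\<close> makes points of \<open>Y\<close> representable by points of \<open>X\<close>, so that a covering of
  \<open>X\<close> by inverse images comes from a covering of \<open>Y\<close>. The inclusion of \<open>S\<close> in the soft sets over \<open>Y\<close>
  does the same for disjointness: soft open sets must not meet outside the range of \<open>r\<close>.
\<close>

lemma soft_regular_vimage:
  assumes surj: "r ` X = Y" and S: "S \<subseteq> soft_sets Y A"
  shows "soft_regular X A (soft_vimage X A r ` S) \<longleftrightarrow> soft_regular Y A S"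
proof -
  have cover: "(\<forall>a\<in>A. X \<subseteq> soft_vimage X A r U a \<union> soft_vimage X A r H a) \<longleftrightarrow>
      (\<forall>a\<in>A. Y \<subseteq> U a \<union> H a)" for U H
    unfolding surj[symmetric] by (auto simp: soft_vimage_def)
  have disjoint: "(\<forall>a\<in>A. soft_vimage X A r G a \<inter> soft_vimage X A r H a = {}) \<longleftrightarrow>
      (\<forall>a\<in>A. G a \<inter> H a = {})" if "G \<in> S" for G H
  proof -
    have "G a \<subseteq> r ` X" if "a \<in> A" for a
      using \<open>G \<in> S\<close> S that unfolding surj soft_sets_def by blast
    then show ?thesis
      by (fastforce simp: soft_vimage_def)
  qed
  have mem: "x \<in> soft_vimage X A r F a \<longleftrightarrow> r x \<in> F a" if "x \<in> X" "a \<in> A" for x a F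
    using that by (simp add: soft_vimage_def)
  show ?thesis
    unfolding soft_regular_iff_open
    by (simp add: cover disjoint mem surj[symmetric] cong: bex_cong ball_cong)
qed

lemma refl_map_image: "refl_map X A T ` X = refl_space X A T"
  by (auto simp: refl_map_def refl_space_def quotient_def)

text \<open>
  The image of a soft open set \<open>F\<close> under the canonical surjection pulls back to \<open>F\<close> itself: if the
  class of \<open>x\<close> is the class of some \<open>y \<in> F a\<close>, then \<open>x\<close> and \<open>y\<close> are indistinguishable and the soft
  \<open>T\<^sub>0\<^sub>U\<close> axiom puts \<open>x\<close> into the same part \<open>F a\<close>.
\<close>

lemma soft_topology_eq_vimage_refl:
  assumes T: "soft_topology X A T" and T0U: "soft_T0U X A T"
  shows "T = soft_vimage X A (refl_map X A T) ` refl_topology X A T"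
proof
  let ?r = "refl_map X A T"
  show "soft_vimage X A ?r ` refl_topology X A T \<subseteq> T"
    by (auto simp: refl_topology_def soft_vimage_def)
  show "T \<subseteq> soft_vimage X A ?r ` refl_topology X A T"
  proof
    fix F assume F: "F \<in> T"
    then have FX: "F \<in> soft_sets X A"
      using T unfolding soft_topology_def by blast
    have part: "F a \<subseteq> X" if "a \<in> A" for a
      using FX that unfolding soft_sets_def by blast
    define Q where "Q = (\<lambda>a\<in>A. ?r ` F a)"
    have saturated: "x \<in> F a" if "a \<in> A" "x \<in> X" "y \<in> F a" "?r x = ?r y" for a x y
    proof -
      have "(x, y) \<in> soft_indist X A T"
        using that part[OF \<open>a \<in> A\<close>] eq_equiv_class_iff[OF equiv_soft_indist[OF T]]
        unfolding refl_map_def by blast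
      then show ?thesis
        using T0U F that unfolding soft_T0U_def by blast
    qed
    have "soft_vimage X A ?r Q a = F a" for a
    proof (cases "a \<in> A")
      case True
      then have "soft_vimage X A ?r Q a = {x \<in> X. ?r x \<in> ?r ` F a}"
        by (simp add: soft_vimage_def Q_def)
      also have "\<dots> = F a"
      proof
        show "{x \<in> X. ?r x \<in> ?r ` F a} \<subseteq> F a"
        proof
          fix x assume "x \<in> {x \<in> X. ?r x \<in> ?r ` F a}"
          then obtain y where "x \<in> X" "y \<in> F a" "?r x = ?r y"
            by blast
          then show "x \<in> F a"
            by (rule saturated[OF True])
        qed
        show "F a \<subseteq> {x \<in> X. ?r x \<in> ?r ` F a}"
          using part[OF True] by blast
      qed
      finally show ?thesis .
    next
      case False
      then show ?thesis
        using PiE_arb[OF FX[unfolded soft_sets_def] False] by (simp add: soft_vimage_def)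
    qed
    then have pull: "soft_vimage X A ?r Q = F"
      by (rule ext)
    have "Q \<in> soft_sets (refl_space X A T) A"
      unfolding soft_sets_def Q_def refl_map_image[symmetric] using part by auto
    then have "Q \<in> refl_topology X A T"
      using F pull by (simp add: refl_topology_def soft_vimage_def)
    then show "F \<in> soft_vimage X A ?r ` refl_topology X A T"
      using pull by blast
  qed
qed

theorem proposition4p7:
  fixes X :: "'a set" and A :: "'p set" and T :: "('p \<Rightarrow> 'a set) set"
  assumes "soft_topology X A T"
    and "soft_T0U X A T"
  shows "soft_T03 X A T \<longleftrightarrow> soft_T01 X A T \<and> soft_regular X A T"
proof -
  have "refl_topology X A T \<subseteq> soft_sets (refl_space X A T) A"
    by (auto simp: refl_topology_def)
  from soft_regular_vimage[OF refl_map_image this]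
  have "soft_regular X A T \<longleftrightarrow> soft_regular (refl_space X A T) A (refl_topology X A T)"
    using soft_topology_eq_vimage_refl[OF assms] by simp
  then show ?thesis
    unfolding soft_T03_def soft_T01_def soft_T3_def by blast
qed

end
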